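(* Let $A\in\mathbb{R}^{n\times n}$, $B\in\mathbb{R}^{n\times m}$ and consider the discrete-time linear system $\Sigma: x^+=Ax+Bu$. Let $X\subseteq\mathbb{R}^n$ be a closed convex set and $U\subseteq\mathbb{R}^m$ a compact convex set (state and input constraint sets). Let $x_0\in X$. (i) If $x_0$ is open-loop convex feasible with respect to $(X,U)$, then there exist an input trajectory $\mathbf{u}:\mathbb{N}_{\ge 0}\to U$ and an integer $N>0$ such that the set $$S=\mathrm{cl}\left(\mathrm{ch}\left(\{\Phi(t,x_0,\mathbf{u})\mid 0\le t\le N-1\}\right)\right)$$ is a controlled invariant for $\Sigma$ and constraint set $(X,U)$. (ii) If $x_0$ is closed-loop convex feasible with respect to $(X,U)$, then there exist a controller $\kappa:X\to U$ and an integer $N>0$ such that the set $$S=\mathrm{cl}\left(\mathrm{ch}\left(\{\Phi_\kappa(t,x_0)\mid 0\le t\le N-1\}\right)\right)$$ is a controlled invariant for $\Sigma$ and constraint set $(X,U)$.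
   Context: $\mathrm{ch}$ denotes convex hull and $\mathrm{cl}$ closure; $\mathcal{B}_\epsilon(0)=\{z\in\mathbb{R}^n\mid\|z\|\le\epsilon\}$ (Euclidean norm). Trajectories: $\Phi(t,x_0,\mathbf{u})$ is the state reached at time $t\in\mathbb{N}_{\ge0}$ by $x^+=Ax+Bu$ from the initial state $x_0$ under the input sequence $\mathbf{u}$, i.e. $\Phi(0,x_0,\mathbf{u})=x_0$, $\Phi(t+1,x_0,\mathbf{u})=A\Phi(t,x_0,\mathbf{u})+B\mathbf{u}(t)$. For a state-feedback controller $\kappa$, $\Phi_\kappa(t,x_0)$ is the state reached at time $t$ by the closed-loop system $x^+=Ax+B\kappa(x)$ from $x_0$ (defined as long as the previous states lie in the domain of $\kappa$). Controlled invariant: a set $S$ is a controlled invariant for $\Sigma$ and constraint set $(X,U)$ if $S\subseteq X$ and for every $x\in S$ there exists $u\in U$ with $Ax+Bu\in S$. Open-loop convex feasible: $x_0\in X$ is open-loop convex feasible with respect to $(X,U)$ if there exist $\epsilon>0$, an input trajectory $\mathbf{u}:\mathbb{N}_{\ge0}\to U$ and an integer $N>n+1$ such that $\Phi(t,x_0,\mathbf{u})\in X$ for all $0\le t\le N-1$ and $\Phi(N,x_0,\mathbf{u})+\mathcal{B}_\epsilon(0)\subseteq\mathrm{ch}\left(\bigcup_{t=0}^{N-1}\{\Phi(t,x_0,\mathbf{u})\}\right)$. Closed-loop convex feasible: $x_0\in X$ is closed-loop convex feasible with respect to $(X,U)$ if there exist $\epsilon>0$, a controller $\kappa:X\to U$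 and an integer $N>n+1$ such that $\Phi_\kappa(t,x_0)\in X$ for all $0\le t\le N-1$ and $\Phi_\kappa(N,x_0)+\mathcal{B}_\epsilon(0)\subseteq\mathrm{ch}\left(\bigcup_{t=0}^{N-1}\{\Phi_\kappa(t,x_0)\}\right)$. *)

theory Defs
  imports "HOL-Analysis.Analysis"
begin

primrec traj ::
  "real^'n^'n \<Rightarrow> real^'m^'n \<Rightarrow> real^'n \<Rightarrow> (nat \<Rightarrow> real^'m) \<Rightarrow> nat \<Rightarrow> real^'n"
where
  "traj A B x0 u 0 = x0"
| "traj A B x0 u (Suc t) = A *v traj A B x0 u t + B *v u t"

text \<open>A controller on \<open>X\<close> with values in \<open>U\<close> is a total function \<open>\<kappa> \<in> X \<rightarrow> U\<close>. Its values outside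
  \<open>X\<close> are never relevant below: wherever a closed-loop state is used, all the preceding states are
  also required to lie in \<open>X\<close>.\<close>

primrec cl_traj ::
  "real^'n^'n \<Rightarrow> real^'m^'n \<Rightarrow> real^'n \<Rightarrow> (real^'n \<Rightarrow> real^'m) \<Rightarrow> nat \<Rightarrow> real^'n"
where
  "cl_traj A B x0 \<kappa> 0 = x0"
| "cl_traj A B x0 \<kappa> (Suc t) = A *v cl_traj A B x0 \<kappa> t + B *v \<kappa> (cl_traj A B x0 \<kappa> t)"

definition controlled_invariant ::
  "real^'n^'n \<Rightarrow> real^'m^'n \<Rightarrow> (real^'n) set \<Rightarrow> (real^'m) set \<Rightarrow> (real^'n) set \<Rightarrow> bool"
where
  "controlled_invariant A B X U S \<longleftrightarrow>
     S \<subseteq> X \<and> (\<forall>x\<in>S. \<exists>u\<in>U. A *v x + B *v u \<in> S)"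

definition open_loop_convex_feasible ::
  "real^'n^'n \<Rightarrow> real^'m^'n \<Rightarrow> (real^'n) set \<Rightarrow> (real^'m) set \<Rightarrow> real^'n \<Rightarrow> bool"
where
  "open_loop_convex_feasible A B X U x0 \<longleftrightarrow>
     x0 \<in> X \<and>
     (\<exists>\<epsilon>>0. \<exists>u \<in> UNIV \<rightarrow> U. \<exists>N. N > CARD('n) + 1 \<and>
        (\<forall>t\<in>{0..N-1}. traj A B x0 u t \<in> X) \<and>
        (\<lambda>z. traj A B x0 u N + z) ` cball 0 \<epsilon>
          \<subseteq> convex hull (\<Union>t\<in>{0..N-1}. {traj A B x0 u t}))"

definition closed_loop_convex_feasible ::
  "real^'n^'n \<Rightarrow> real^'m^'n \<Rightarrow> (real^'n) set \<Rightarrow> (real^'m) set \<Rightarrow> real^'n \<Rightarrow> bool"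
where
  "closed_loop_convex_feasible A B X U x0 \<longleftrightarrow>
     x0 \<in> X \<and>
     (\<exists>\<epsilon>>0. \<exists>\<kappa> \<in> X \<rightarrow> U. \<exists>N. N > CARD('n) + 1 \<and>
        (\<forall>t\<in>{0..N-1}. cl_traj A B x0 \<kappa> t \<in> X) \<and>
        (\<lambda>z. cl_traj A B x0 \<kappa> N + z) ` cball 0 \<epsilon>
          \<subseteq> convex hull (\<Union>t\<in>{0..N-1}. {cl_traj A B x0 \<kappa> t}))"

end

theory Submission
  imports Defs
begin

text \<open>Whether a state can be steered into a convex set by an admissible input is a convex condition
  on the state, so it suffices to check invariance of a hull at its generators. Along a trajectory
  every generator but the last moves to the next one, and the last moves to the state at time \<open>N\<close>,
  which feasibility puts back into the hull.\<close>

text \<open>The next state is jointly linear in state and input, so mixing two admissible inputs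
  with the weights used for the states mixes the two successors alike; convexity of \<open>U\<close>
  and \<open>H\<close> admits both mixtures.\<close>

lemma convex_one_step_controllable:
  fixes A :: "real^'n^'n" and B :: "real^'m^'n"
  assumes "convex U" and "convex H"
  shows "convex {x. \<exists>u\<in>U. A *v x + B *v u \<in> H}"
proof (rule convexI, clarify)
  fix x y u v and a b :: real
  assume ab: "0 \<le> a" "0 \<le> b" "a + b = 1" and u: "u \<in> U" and v: "v \<in> U"
    and xu: "A *v x + B *v u \<in> H" and yv: "A *v y + B *v v \<in> H"
  have "A *v (a *\<^sub>R x + b *\<^sub>R y) + B *v (a *\<^sub>R u + b *\<^sub>R v)
      = a *\<^sub>R (A *v x + B *v u) + b *\<^sub>R (A *v y + B *v v)"
    by (simp add: matrix_vector_right_distrib matrix_vector_mult_scaleR algebra_simps)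
  also have "\<dots> \<in> H"
    using convexD[OF assms(2) xu yv ab] .
  finally show "\<exists>w\<in>U. A *v (a *\<^sub>R x + b *\<^sub>R y) + B *v w \<in> H"
    using convexD[OF assms(1) u v ab] by blast
qed

text \<open>A finite \<open>P\<close> has a compact hull, so taking the closure adds nothing. Both
  \<open>X\<close> and the set of states that can be steered into the hull are convex and contain
  \<open>P\<close>, hence contain the hull.\<close>

lemma controlled_invariant_closure_convex_hull:
  fixes A :: "real^'n^'n" and B :: "real^'m^'n"
  assumes "convex X" and "convex U" and "finite P" and "P \<subseteq> X"
    and step: "\<And>x. x \<in> P \<Longrightarrow> \<exists>u\<in>U. A *v x + B *v u \<in> convex hull P"
  shows "controlled_invariant A B X U (closure (convex hull P))"
proof -
  have "closure (convex hull P) = convex hull P"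
    using \<open>finite P\<close> by (simp add: compact_imp_closed finite_imp_compact_convex_hull)
  moreover have "convex hull P \<subseteq> X"
    using assms by (simp add: hull_minimal)
  moreover have "convex hull P \<subseteq> {x. \<exists>u\<in>U. A *v x + B *v u \<in> convex hull P}"
    using convex_one_step_controllable[OF \<open>convex U\<close> convex_convex_hull] step
    by (intro hull_minimal) auto
  ultimately show ?thesis
    unfolding controlled_invariant_def by auto
qed

text \<open>Common core of the open-loop and closed-loop cases: \<open>dyn\<close> asks only that
  each transition be realised by some input in \<open>U\<close>, whether chosen by time or by
  state.\<close>

lemma controlled_invariant_orbit_segment:
  fixes A :: "real^'n^'n" and B :: "real^'m^'n" and \<xi> :: "nat \<Rightarrow> real^'n"
  assumes "convex X" and "convex U" and "N > 0"
    and inX: "\<And>t. t \<le> N - 1 \<Longrightarrow> \<xi> t \<in> X"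
    and dyn: "\<And>t. t \<le> N - 1 \<Longrightarrow> \<exists>u\<in>U. \<xi> (Suc t) = A *v \<xi> t + B *v u"
    and last: "\<xi> N \<in> convex hull (\<xi> ` {0..N-1})"
  shows "controlled_invariant A B X U (closure (convex hull {\<xi> t | t. 0 \<le> t \<and> t \<le> N - 1}))"
proof -
  have eq: "{\<xi> t | t. 0 \<le> t \<and> t \<le> N - 1} = \<xi> ` {0..N-1}"
    by auto
  have next_in: "\<xi> (Suc t) \<in> convex hull (\<xi> ` {0..N-1})" if "t \<le> N - 1" for t
  proof (cases "Suc t = N")
    case True
    then show ?thesis using last by simp
  next
    case False
    \<comment> \<open>Since \<open>N > 0\<close>, truncated subtraction is harmless:
      \<open>t \<le> N - 1\<close> and \<open>Suc t \<noteq> N\<close> give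
      \<open>Suc t \<le> N - 1\<close>, so the successor is itself a generator.\<close>
    with that \<open>N > 0\<close> show ?thesis by (intro hull_inc) auto
  qed
  show ?thesis
    unfolding eq
  proof (rule controlled_invariant_closure_convex_hull[OF assms(1,2)])
    fix x assume "x \<in> \<xi> ` {0..N-1}"
    then obtain t where t: "t \<le> N - 1" "x = \<xi> t" by auto
    then show "\<exists>u\<in>U. A *v x + B *v u \<in> convex hull (\<xi> ` {0..N-1})"
      using dyn[OF t(1)] next_in[OF t(1)] by auto
  qed (use inX in auto)
qed

text \<open>Take \<open>z = 0\<close>. This turns the ball inclusion of feasibility into the
  assumption \<open>last\<close> on the state at time \<open>N\<close>.\<close>

lemma translated_cball_subset_centre:
  fixes p :: "'a::real_normed_vector"
  assumes "(\<lambda>z. p + z) ` cball 0 \<epsilon> \<subseteq> H" and "\<epsilon> > 0"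
  shows "p \<in> H"
proof -
  have "p + 0 \<in> (\<lambda>z. p + z) ` cball 0 \<epsilon>"
    using \<open>\<epsilon> > 0\<close> by (intro imageI) simp
  with assms(1) show ?thesis by auto
qed

theorem theorem2:
  fixes A :: "real^'n^'n" and B :: "real^'m^'n"
    and X :: "(real^'n) set" and U :: "(real^'m) set"
    and x0 :: "real^'n"
  assumes "closed X" and "convex X"
    and "compact U" and "convex U"
    and "x0 \<in> X"
  shows "(open_loop_convex_feasible A B X U x0 \<longrightarrow>
            (\<exists>u \<in> UNIV \<rightarrow> U. \<exists>N>0.
               controlled_invariant A B X U
                 (closure (convex hull {traj A B x0 u t | t. 0 \<le> t \<and> t \<le> N - 1}))))
       \<and> (closed_loop_convex_feasible A B X U x0 \<longrightarrow>
            (\<exists>\<kappa> \<in> X \<rightarrow> U. \<exists>N>0.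
               controlled_invariant A B X U
                 (closure (convex hull {cl_traj A B x0 \<kappa> t | t. 0 \<le> t \<and> t \<le> N - 1}))))"
proof (intro conjI impI)
  assume "open_loop_convex_feasible A B X U x0"
  then obtain \<epsilon> u N where "\<epsilon> > 0" and u: "u \<in> UNIV \<rightarrow> U" and N: "N > CARD('n) + 1"
    and inX: "\<forall>t\<in>{0..N-1}. traj A B x0 u t \<in> X"
    and ball: "(\<lambda>z. traj A B x0 u N + z) ` cball 0 \<epsilon>
        \<subseteq> convex hull (\<Union>t\<in>{0..N-1}. {traj A B x0 u t})"
    unfolding open_loop_convex_feasible_def by blast
  have "controlled_invariant A B X U
      (closure (convex hull {traj A B x0 u t | t. 0 \<le> t \<and> t \<le> N - 1}))"
  proof (rule controlled_invariant_orbit_segment[OF assms(2,4)])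
    show "traj A B x0 u N \<in> convex hull (traj A B x0 u ` {0..N-1})"
      using translated_cball_subset_centre[OF ball \<open>\<epsilon> > 0\<close>] by (simp only: UNION_singleton_eq_range)
  qed (use N inX u in auto)
  \<comment> \<open>The witnesses are the input trajectory and the horizon supplied by
    feasibility.\<close>
  with u N show "\<exists>u \<in> UNIV \<rightarrow> U. \<exists>N>0. controlled_invariant A B X U
      (closure (convex hull {traj A B x0 u t | t. 0 \<le> t \<and> t \<le> N - 1}))"
    by (intro bexI exI[of _ N] conjI) simp_all
next
  assume "closed_loop_convex_feasible A B X U x0"
  then obtain \<epsilon> \<kappa> N where "\<epsilon> > 0" and \<kappa>: "\<kappa> \<in> X \<rightarrow> U" and N: "N > CARD('n) + 1"
    and inX: "\<forall>t\<in>{0..N-1}. cl_traj A B x0 \<kappa> t \<in> X"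
    and ball: "(\<lambda>z. cl_traj A B x0 \<kappa> N + z) ` cball 0 \<epsilon>
        \<subseteq> convex hull (\<Union>t\<in>{0..N-1}. {cl_traj A B x0 \<kappa> t})"
    unfolding closed_loop_convex_feasible_def by blast
  have "controlled_invariant A B X U
      (closure (convex hull {cl_traj A B x0 \<kappa> t | t. 0 \<le> t \<and> t \<le> N - 1}))"
  proof (rule controlled_invariant_orbit_segment[OF assms(2,4)])
    show "cl_traj A B x0 \<kappa> N \<in> convex hull (cl_traj A B x0 \<kappa> ` {0..N-1})"
      using translated_cball_subset_centre[OF ball \<open>\<epsilon> > 0\<close>] by (simp only: UNION_singleton_eq_range)
  \<comment> \<open>The input at time \<open>t\<close> is \<open>\<kappa>\<close> of the current
    state. It lies in \<open>U\<close> because \<open>inX\<close> keeps that state in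
    \<open>X\<close>, where \<open>\<kappa>\<close> takes values in \<open>U\<close>.\<close>
  qed (use N inX \<kappa> in auto)
  with \<kappa> N show "\<exists>\<kappa> \<in> X \<rightarrow> U. \<exists>N>0. controlled_invariant A B X U
      (closure (convex hull {cl_traj A B x0 \<kappa> t | t. 0 \<le> t \<and> t \<le> N - 1}))"
    by (intro bexI exI[of _ N] conjI) simp_all
qed

end
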